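(* Let $\mathbb{k}$ be a field, $G$ a finite abelian group and $q=\tilde q\cdot\eta$ a weak quadratic form on $G$ with values in $\mathbb{k}^\times$, where $\tilde q: G\to\mathbb{k}^\times$ is a quadratic form and $\eta: G\to\mathbb{k}^\times$ is a character. If there exists some $g_0\in G$ such that $\eta(g)=\beta_q(g,g_0)$ for all $g\in G$, then $$q(g)=\frac{\tilde q(gg_0)}{\tilde q(g_0)}\qquad\text{for all }g\in G.$$ In particular, $q$ is symmetric with respect to $\tilde g_0:=g_0^{-2}$, i.e. $$q(g)=q(\tilde g_0g^{-1})\qquad\text{for all }g\in G.$$
   Context: For $q: G\to\mathbb{k}^\times$ put $\beta_q(g_1,g_2)=q(g_1g_2)q(g_1)^{-1}q(g_2)^{-1}$. $q$ is a weak quadratic form if $\beta_q$ is a bihomomorphism, and a quadratic form if in addition $q(g)=q(g^{-1})$ for all $g\in G$. A character is a group homomorphism $G\to\mathbb{k}^\times$. *)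

theory Defs
  imports "HOL-Algebra.Multiplicative_Group"
begin

text \<open>
  The group of nonzero elements of a field \<open>K\<close> is \<open>mult_of K\<close>. Functions on a group \<open>G\<close> are
  only constrained on \<open>carrier G\<close>.
\<close>

definition characters :: "('a, 'm) monoid_scheme \<Rightarrow> ('k, 'n) ring_scheme \<Rightarrow> ('a \<Rightarrow> 'k) set"
  where "characters G K = hom G (mult_of K)"

definition bihomomorphisms ::
    "('a, 'm) monoid_scheme \<Rightarrow> ('k, 'n) ring_scheme \<Rightarrow> ('a \<Rightarrow> 'a \<Rightarrow> 'k) set"
  where "bihomomorphisms G K =
    {b. \<forall>h \<in> carrier G. (\<lambda>g. b g h) \<in> hom G (mult_of K) \<and> (\<lambda>g. b h g) \<in> hom G (mult_of K)}"

text \<open>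
  On nonzero field elements, \<open>inv\<^bsub>K\<^esub>\<close> is also the inverse in \<open>mult_of K\<close>.
\<close>

definition beta ::
    "('a, 'm) monoid_scheme \<Rightarrow> ('k, 'n) ring_scheme \<Rightarrow> ('a \<Rightarrow> 'k) \<Rightarrow> 'a \<Rightarrow> 'a \<Rightarrow> 'k"
  where "beta G K q g1 g2 =
    q (g1 \<otimes>\<^bsub>G\<^esub> g2) \<otimes>\<^bsub>K\<^esub> inv\<^bsub>K\<^esub> (q g1) \<otimes>\<^bsub>K\<^esub> inv\<^bsub>K\<^esub> (q g2)"

definition weak_quadratic_form ::
    "('a, 'm) monoid_scheme \<Rightarrow> ('k, 'n) ring_scheme \<Rightarrow> ('a \<Rightarrow> 'k) \<Rightarrow> bool"
  where "weak_quadratic_form G K q \<longleftrightarrow>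
    q \<in> carrier G \<rightarrow> carrier (mult_of K) \<and> beta G K q \<in> bihomomorphisms G K"

definition quadratic_form ::
    "('a, 'm) monoid_scheme \<Rightarrow> ('k, 'n) ring_scheme \<Rightarrow> ('a \<Rightarrow> 'k) \<Rightarrow> bool"
  where "quadratic_form G K q \<longleftrightarrow>
    weak_quadratic_form G K q \<and> (\<forall>g \<in> carrier G. q g = q (inv\<^bsub>G\<^esub> g))"

end

theory Submission
  imports Defs
begin

text \<open>Multiplying a function by a character \<eta> does not change its \<beta>, since
  \<eta>(gh) = \<eta>(g)\<eta>(h) cancels the factors that \<eta> contributes
  (\<open>beta_mult_character\<close>). Hence \<eta>(g) = \<beta>(g, \<open>g\<^sub>0\<close>) can
  be computed from \<open>q'\<close> instead of \<open>q\<close>, and in \<open>q g\<close> =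
  \<open>q' g\<close> \<eta>(g) the factor \<open>q' g\<close> cancels, leaving \<open>q'\<close> at
  the translate of g by \<open>g\<^sub>0\<close>, divided by \<open>q' g\<^sub>0\<close>. So
  \<open>q\<close> is a rescaled translate of \<open>q'\<close>, and the symmetry of
  \<open>q'\<close> under inversion becomes a symmetry of \<open>q\<close>: the reflection of g that
  inverts its translate is the inverse of g times the power -2 of \<open>g\<^sub>0\<close>.\<close>

context comm_group
begin

lemma mult_inv_mult_cancel:
  assumes "a \<in> carrier G" "b \<in> carrier G" "x \<in> carrier G"
  shows "a \<otimes> x \<otimes> inv (b \<otimes> x) = a \<otimes> inv b"
proof -
  have "x \<otimes> (inv x \<otimes> inv b) = inv b"
    using assms by (simp add: m_assoc[symmetric])
  then show ?thesis
    using assms by (simp add: inv_mult_group m_assoc)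
qed

text \<open>This is the cancellation behind the invariance of \<beta>: \<open>x\<close> and
  \<open>y\<close> stand for the character values at the two arguments, and
  \<open>x \<otimes> y\<close> for its value at their product.\<close>

lemma mult_inv_mult_cancel_both:
  assumes "a \<in> carrier G" "b \<in> carrier G" "c \<in> carrier G" "x \<in> carrier G" "y \<in> carrier G"
  shows "a \<otimes> (x \<otimes> y) \<otimes> inv (b \<otimes> x) \<otimes> inv (c \<otimes> y) = a \<otimes> inv b \<otimes> inv c"
proof -
  have "a \<otimes> (x \<otimes> y) \<otimes> inv (b \<otimes> x) = a \<otimes> y \<otimes> x \<otimes> inv (b \<otimes> x)"
    using assms by (simp add: m_assoc m_comm[of x y])
  also have "\<dots> = a \<otimes> y \<otimes> inv b"
    using assms by (intro mult_inv_mult_cancel) auto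
  also have "\<dots> = a \<otimes> inv b \<otimes> y"
    using assms by (simp add: m_assoc m_comm[of y])
  finally show ?thesis
    using assms by (simp add: mult_inv_mult_cancel)
qed

lemma mult_inv_cancel_middle:
  assumes "a \<in> carrier G" "b \<in> carrier G" "c \<in> carrier G"
  shows "a \<otimes> (b \<otimes> inv a \<otimes> c) = b \<otimes> c"
proof -
  have "a \<otimes> (b \<otimes> inv a \<otimes> c) = a \<otimes> (inv a \<otimes> (b \<otimes> c))"
    using assms by (simp add: m_assoc m_lcomm[of b "inv a"])
  also have "\<dots> = b \<otimes> c"
    using assms by (simp add: m_assoc[symmetric])
  finally show ?thesis .
qed

end

text \<open>Inverses of nonzero elements agree in \<open>K\<close> and \<open>mult_of K\<close>.
  Written entirely in \<open>mult_of K\<close>, \<beta> becomes accessible to the cancellation laws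
  of commutative groups.\<close>

lemma beta_mult_of:
  assumes "field K" and "group G" and "q \<in> carrier G \<rightarrow> carrier (mult_of K)"
    and "g \<in> carrier G" and "h \<in> carrier G"
  shows "beta G K q g h = q (g \<otimes>\<^bsub>G\<^esub> h) \<otimes>\<^bsub>mult_of K\<^esub> inv\<^bsub>mult_of K\<^esub> (q g)
    \<otimes>\<^bsub>mult_of K\<^esub> inv\<^bsub>mult_of K\<^esub> (q h)"
  using field.m_inv_mult_of[OF assms(1)] assms(3-5) by (auto simp: beta_def Pi_iff)

lemma beta_mult_character:
  fixes G (structure) and K (structure)
  assumes "field K" and "group G" and q': "q' \<in> carrier G \<rightarrow> carrier (mult_of K)"
    and \<eta>: "\<eta> \<in> characters G K"
    and q: "\<And>g. g \<in> carrier G \<Longrightarrow> q g = q' g \<otimes>\<^bsub>K\<^esub> \<eta> g"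
    and g: "g \<in> carrier G" and h: "h \<in> carrier G"
  shows "beta G K q g h = beta G K q' g h"
proof -
  interpret K: field K by fact
  interpret G: group G by fact
  interpret M: comm_group "mult_of K"
    by (rule K.units_comm_group[folded K.mult_of_is_Units])
  have \<eta>_closed: "\<eta> x \<in> carrier (mult_of K)" if "x \<in> carrier G" for x
    using \<eta> that by (auto simp: characters_def hom_def)
  have \<eta>_mult: "\<eta> (g \<otimes>\<^bsub>G\<^esub> h) = \<eta> g \<otimes>\<^bsub>mult_of K\<^esub> \<eta> h"
    using \<eta> g h by (auto simp: characters_def hom_def)
  have q_M: "q x = q' x \<otimes>\<^bsub>mult_of K\<^esub> \<eta> x" if "x \<in> carrier G" for x
    using q that by simp
  have q_closed: "q \<in> carrier G \<rightarrow> carrier (mult_of K)"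
    using q_M \<eta>_closed q' by (metis M.m_closed Pi_iff)
  show ?thesis
    unfolding beta_mult_of[OF assms(1,2) q_closed g h] beta_mult_of[OF assms(1,2) q' g h]
    \<comment> \<open>The two deleted simp rules would translate \<open>mult_of K\<close> back to
      \<open>K\<close>, and the cancellation law for the group would no longer match.\<close>
    using M.mult_inv_mult_cancel_both q' g h \<eta>_closed by (simp add: q_M \<eta>_mult Pi_iff del: mult_mult_of carrier_mult_of)
qed

theorem corollary4p2p4:
  fixes G :: "('a, 'm) monoid_scheme"
    and K :: "('k, 'n) ring_scheme"
    and q q' \<eta> :: "'a \<Rightarrow> 'k"
    and g\<^sub>0 :: 'a
  assumes "field K"
    and "comm_group G"
    and "finite (carrier G)"
    and "weak_quadratic_form G K q"
    and "quadratic_form G K q'"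
    and "\<eta> \<in> characters G K"
    and "\<forall>g \<in> carrier G. q g = q' g \<otimes>\<^bsub>K\<^esub> \<eta> g"
    and "g\<^sub>0 \<in> carrier G"
    and "\<forall>g \<in> carrier G. \<eta> g = beta G K q g g\<^sub>0"
  shows "(\<forall>g \<in> carrier G. q g = q' (g \<otimes>\<^bsub>G\<^esub> g\<^sub>0) \<otimes>\<^bsub>K\<^esub> inv\<^bsub>K\<^esub> (q' g\<^sub>0)) \<and>
    (\<forall>g \<in> carrier G. q g = q ((g\<^sub>0 [^]\<^bsub>G\<^esub> (-2 :: int)) \<otimes>\<^bsub>G\<^esub> inv\<^bsub>G\<^esub> g))"
proof -
  interpret K: field K by fact
  interpret G: comm_group G by fact
  interpret M: comm_group "mult_of K"
    by (rule K.units_comm_group[folded K.mult_of_is_Units])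
  have q': "q' \<in> carrier G \<rightarrow> carrier (mult_of K)"
    using assms(5) by (simp add: quadratic_form_def weak_quadratic_form_def)
  have q'_inv: "q' (inv\<^bsub>G\<^esub> g) = q' g" if "g \<in> carrier G" for g
    using assms(5) that unfolding quadratic_form_def by metis
  have shift: "q g = q' (g \<otimes>\<^bsub>G\<^esub> g\<^sub>0) \<otimes>\<^bsub>K\<^esub> inv\<^bsub>K\<^esub> (q' g\<^sub>0)" if g: "g \<in> carrier G" for g
  proof -
    have closed: "q' g \<in> carrier (mult_of K)" "q' g\<^sub>0 \<in> carrier (mult_of K)"
        "q' (g \<otimes>\<^bsub>G\<^esub> g\<^sub>0) \<in> carrier (mult_of K)"
      using q' g assms(8) by blast+
    \<comment> \<open>The hypothesis gives this with \<open>q\<close> in place of \<open>q'\<close>;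
      the two forms have the same \<beta>.\<close>
    have "\<eta> g = beta G K q' g g\<^sub>0"
      using beta_mult_character[OF assms(1) G.is_group q' assms(6) _ g assms(8)] assms(7,9) g
      by metis
    then have "q g = q' g \<otimes>\<^bsub>mult_of K\<^esub> (q' (g \<otimes>\<^bsub>G\<^esub> g\<^sub>0)
        \<otimes>\<^bsub>mult_of K\<^esub> inv\<^bsub>mult_of K\<^esub> (q' g) \<otimes>\<^bsub>mult_of K\<^esub> inv\<^bsub>mult_of K\<^esub> (q' g\<^sub>0))"
      using beta_mult_of[OF assms(1) G.is_group q' g assms(8)] assms(7) g by simp
    also have "\<dots> = q' (g \<otimes>\<^bsub>G\<^esub> g\<^sub>0) \<otimes>\<^bsub>mult_of K\<^esub> inv\<^bsub>mult_of K\<^esub> (q' g\<^sub>0)"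
      using M.mult_inv_cancel_middle[OF closed(1,3) M.inv_closed[OF closed(2)]] .
    finally show ?thesis
      using K.m_inv_mult_of closed by simp
  qed
  have "q g = q ((g\<^sub>0 [^]\<^bsub>G\<^esub> (-2 :: int)) \<otimes>\<^bsub>G\<^esub> inv\<^bsub>G\<^esub> g)" if g: "g \<in> carrier G" for g
  proof -
    \<comment> \<open>Translating by \<open>g\<^sub>0\<close> raises the exponent from -2 to -1, so
      the reflected point is translated to the inverse of the translate of g.\<close>
    have "g\<^sub>0 [^]\<^bsub>G\<^esub> (-2 :: int) \<otimes>\<^bsub>G\<^esub> g\<^sub>0 = inv\<^bsub>G\<^esub> g\<^sub>0"
      using G.int_pow_mult[OF assms(8), of "-2" 1] assms(8) by (simp add: G.int_pow_neg)
    moreover have "(g\<^sub>0 [^]\<^bsub>G\<^esub> (-2 :: int)) \<otimes>\<^bsub>G\<^esub> inv\<^bsub>G\<^esub> g \<otimes>\<^bsub>G\<^esub> g\<^sub>0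
        = inv\<^bsub>G\<^esub> g \<otimes>\<^bsub>G\<^esub> (g\<^sub>0 [^]\<^bsub>G\<^esub> (-2 :: int) \<otimes>\<^bsub>G\<^esub> g\<^sub>0)"
      using g assms(8) by (simp add: G.m_assoc G.m_lcomm del: G.int_pow_neg)
    ultimately have "(g\<^sub>0 [^]\<^bsub>G\<^esub> (-2 :: int)) \<otimes>\<^bsub>G\<^esub> inv\<^bsub>G\<^esub> g \<otimes>\<^bsub>G\<^esub> g\<^sub>0
        = inv\<^bsub>G\<^esub> (g \<otimes>\<^bsub>G\<^esub> g\<^sub>0)"
      using g assms(8) by (simp add: G.inv_mult)
    \<comment> \<open>Applying \<open>shift\<close> at g and at its reflection leaves values of
      \<open>q'\<close> at two mutually inverse points, over the same denominator.\<close>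
    then show ?thesis
      using g assms(8) by (simp add: shift q'_inv)
  qed
  with shift show ?thesis by blast
qed

end
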